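(* Let $\alpha\ge1$ and let $\{a_n\}_{n\in\mathbb{N}_0^d}$ be a sequence of complex numbers such that $a_n\to0$ as $|n|\to\infty$. Then $$F(w)=(\mathbf 1-w)^{\mathbf 1}\sum_{n\in\mathbb{N}_0^d}a_nw^n,\qquad w\in\mathbf D,$$ is analytic on $\mathbf D$. The following conditions are equivalent: (i) There exist constants $C,A>0$ such that $|D^pF(w)|\le CA^{|p|}p^{\alpha p}$ for all $p\in\mathbb{N}_0^d$, $w\in\mathbf D$. (ii) There exist constants $c>0$, $a>1$ such that $|a_n|\le c\,a^{-|n|^{1/\alpha}}$ for all $n\in\mathbb{N}_0^d$.
   Context: $\mathbf D=\{w\in\mathbb{C}^d:\ |w_l|<1,\ l=1,\dots,d\}$, $\mathbb{N}_0=\{0,1,2,\dots\}$, $|n|=n_1+\dots+n_d$, $w^n=\prod_lw_l^{n_l}$, $p^{\alpha p}=\prod_lp_l^{\alpha p_l}$ with $0^0=1$, $\mathbf 1=(1,\dots,1)$, $(\mathbf 1-w)^{\mathbf 1}=\prod_l(1-w_l)$; $D^p$ is the complex partial derivative of order $p$. *)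

theory Defs
  imports "HOL-Analysis.Analysis"
begin

text \<open>
  Points of $\mathbb C^d$ are vectors \<open>complex ^ 'd\<close>, and multi-indices are vectors \<open>nat ^ 'd\<close>,
  where the index type \<open>'d\<close> has $d$ elements. Its linear order is used only to fix the order in
  which iterated partial derivatives are taken.
\<close>

definition unit_polydisc :: "(complex ^ 'd) set" where
  "unit_polydisc = {w. \<forall>l. cmod (w $ l) < 1}"

definition mi_size :: "nat ^ 'd \<Rightarrow> nat" where
  "mi_size n = (\<Sum>l\<in>UNIV. n $ l)"

definition mi_power :: "complex ^ 'd \<Rightarrow> nat ^ 'd \<Rightarrow> complex" where
  "mi_power w n = (\<Prod>l\<in>UNIV. (w $ l) ^ (n $ l))"

text \<open>
  The quantity $p^{\alpha p} = \prod_l p_l^{\alpha p_l}$. The case distinction implements the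
  convention $0^0 = 1$, since \<open>0 powr 0 = 0\<close> in the library.
\<close>

definition mi_self_powr :: "real \<Rightarrow> nat ^ 'd \<Rightarrow> real" where
  "mi_self_powr \<alpha> p =
     (\<Prod>l\<in>UNIV. if p $ l = 0 then 1 else real (p $ l) powr (\<alpha> * real (p $ l)))"

definition partial_deriv :: "'d \<Rightarrow> (complex ^ 'd \<Rightarrow> complex) \<Rightarrow> complex ^ 'd \<Rightarrow> complex" where
  "partial_deriv l f w = deriv (\<lambda>z. f (\<chi> j. if j = l then z else w $ j)) (w $ l)"

text \<open>
  $D^p f = \partial_1^{p_1} (\partial_2^{p_2} ( \cdots \partial_d^{p_d} f))$, with the
  coordinates listed in increasing order.
\<close>

definition mixed_deriv ::
    "nat ^ 'd::{finite,linorder} \<Rightarrow> (complex ^ 'd::{finite,linorder} \<Rightarrow> complex) \<Rightarrow>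
     complex ^ 'd::{finite,linorder} \<Rightarrow> complex" where
  "mixed_deriv p f =
     foldr (\<lambda>l. partial_deriv l ^^ (p $ l)) (sorted_list_of_set UNIV) f"

text \<open>
  Analyticity in several complex variables: around each point of \<open>S\<close> the function is the sum of
  a power series, converging unconditionally (hence absolutely) on some polydisc.
\<close>

definition multi_analytic_on ::
    "(complex ^ 'd \<Rightarrow> complex) \<Rightarrow> (complex ^ 'd) set \<Rightarrow> bool" where
  "multi_analytic_on f S \<longleftrightarrow>
     (\<forall>z\<in>S. \<exists>c. \<exists>r>0. \<forall>w. (\<forall>l. cmod (w $ l - z $ l) < r) \<longrightarrow>
        ((\<lambda>n. c n * mi_power (w - z) n) has_sum f w) UNIV)"

end

theory Submission
  imports Defs "HOL-Complex_Analysis.Cauchy_Integral_Formula" "HOL-Real_Asymp.Real_Asymp"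
begin

text \<open>
  Multiplying a power series by $1 - w_l$ replaces its coefficients $a_n$ by the backward difference
  $a_n - a_{n - e_l}$ in the direction $l$. Hence $F$ is the sum of a power series whose coefficients
  $f_m$ arise from $a$ by one difference in each direction, and the equivalence splits into
  (i) $\Longleftrightarrow$ $f$ decays $\Longleftrightarrow$ $a$ decays, where decay means
  $|g_n| \le C \exp(-c |n|^{1/\alpha})$ for some $C, c > 0$.

  Decay of $a$ versus $f$ (\<open>subexp_decay_total_diff_iff\<close>) is handled one difference at a time.
  A difference keeps decay because $|n|^{1/\alpha}$ changes by at most $1$ when $|n|$ changes by $1$.
  Conversely $a_n \to 0$ allows writing a coefficient as minus the tail sum of the differences along
  the line $n + \mathbb{N} e_l$; the sizes grow by one at each step, so the tail sum inherits the decay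
  with $c$ halved.

  From (i) to decay of $f$ (\<open>gevrey_imp_decay\<close>): if a power series is bounded by $B$ on the
  polydisc, so is each of its coefficients (\<open>Cauchy_estimate_polydisc\<close>). For $D^p F$ this gives
  $|f_n| \prod_l n_l!/(n_l - p_l)! \le C A^{|p|} p^{\alpha p}$ for every $p \le n$, and the choice
  $p_l \approx (n_l/K)^{1/\alpha}$ with $K$ large turns the bound into $\exp(-c \sum_l n_l^{1/\alpha})$
  up to a constant, which is at most $\exp(-c |n|^{1/\alpha})$ because $t \mapsto t^{1/\alpha}$ is
  subadditive. The bound on the whole polydisc is essential: bounds at the origin alone would only give
  $|f_p| \le C A^{|p|} p^{\alpha p} / p!$.

  From decay of $f$ to (i) (\<open>decay_imp_gevrey\<close>): termwise differentiation bounds $|D^p F|$ by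
  $\sum_n n^p |f_n|$. Since $|n|^{1/\alpha} \ge d^{-1} \sum_l n_l^{1/\alpha}$, the decay factors over the
  coordinates; half of it absorbs $n^p$ at the cost of $A^{|p|} p^{\alpha p}$, the other half makes
  the sum over $n$ converge.

  The series for $F$ converges since $a_n \to 0$ bounds the coefficients by a constant and the geometric
  multi-series converges absolutely on the polydisc; recentring it at any point of the polydisc
  (\<open>power_series_imp_analytic\<close>) proves analyticity.
\<close>

section \<open>One-variable estimates\<close>

lemma summable_exp_neg_powr:
  fixes c s :: real
  assumes "c > 0" "s > 0"
  shows "summable (\<lambda>k. exp (- c * real k powr s))"
proof (rule summable_comparison_test_bigo)
  show "summable (\<lambda>k. norm (inverse (real k ^ 2)))"
    using inverse_power_summable[of 2, where 'a = real] by simp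
  show "(\<lambda>k. exp (- c * real k powr s)) \<in> O(\<lambda>k. inverse (real k ^ 2))"
    using assms by real_asymp
qed

text \<open>
  By homogeneity one may divide by $(x + y)^s$, and numbers $u \in [0, 1]$ satisfy $u \<le> u^s$.
\<close>

lemma powr_subadditive:
  fixes x y s :: real
  assumes "0 \<le> x" "0 \<le> y" "0 < s" "s \<le> 1"
  shows "(x + y) powr s \<le> x powr s + y powr s"
proof (cases "x + y = 0")
  case False
  then have t: "x + y > 0" using assms by linarith
  have ge: "u \<le> u powr s" if "0 \<le> u" "u \<le> 1" for u :: real
    using powr_mono'[of s 1 u] that assms by (cases "u = 0") auto
  have "1 = x / (x + y) + y / (x + y)"
    using t by (simp add: add_divide_distrib[symmetric])
  also have "\<dots> \<le> (x / (x + y)) powr s + (y / (x + y)) powr s"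
    using assms t by (intro add_mono ge) auto
  also have "\<dots> = (x powr s + y powr s) / (x + y) powr s"
    using assms t by (simp add: powr_divide add_divide_distrib)
  finally show ?thesis using t by (simp add: field_simps)
qed (use assms in auto)

lemma powr_sum_le:
  fixes x :: "'i \<Rightarrow> real"
  assumes "finite I" "\<And>i. 0 \<le> x i" "0 < s" "s \<le> 1"
  shows "(\<Sum>i\<in>I. x i) powr s \<le> (\<Sum>i\<in>I. x i powr s)"
  using assms(1)
proof (induction I)
  case (insert j I)
  have "(x j + (\<Sum>i\<in>I. x i)) powr s \<le> x j powr s + (\<Sum>i\<in>I. x i) powr s"
    using assms by (intro powr_subadditive sum_nonneg) auto
  with insert show ?case by simp
qed simp

text \<open>
  The case distinction matters because \<open>0 powr 0 = 0\<close>, whereas an order of differentiation $0$ has to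
  contribute the factor $0^0 = 1$.
\<close>

definition self_powr :: "real \<Rightarrow> nat \<Rightarrow> real" where
  "self_powr \<alpha> p = (if p = 0 then 1 else real p powr (\<alpha> * real p))"

text \<open>
  With $x = t^{1/\alpha}$ the claim is that $x e^{-cx/(\alpha p)} \le \alpha p / c$, raised to the power
  $\alpha p$; the former is $y \le e^y$ at $y = cx/(\alpha p)$.
\<close>

lemma power_times_exp_neg_powr_le:
  fixes c \<alpha> :: real and p t :: nat
  assumes "c > 0" "\<alpha> > 0"
  shows "real t ^ p * exp (- c * real t powr (1 / \<alpha>)) \<le> ((\<alpha> / c) powr \<alpha>) ^ p * self_powr \<alpha> p"
proof (cases "p = 0 \<or> t = 0")
  case True
  then show ?thesis using assms by (auto simp: self_powr_def power_0_left)
next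
  case False
  define x where "x = real t powr (1 / \<alpha>)"
  have x: "x > 0" using False by (simp add: x_def)
  have ap: "\<alpha> * p > 0" using False assms by simp
  have mult3: "(u * v * y) powr q = u powr q * v powr q * y powr q"
    if "0 \<le> u" "0 \<le> v" "0 \<le> y" for u v y q :: real
    using that by (simp add: powr_mult)
  have "c * x / (\<alpha> * p) \<le> exp (c * x / (\<alpha> * p))"
    using exp_ge_add_one_self[of "c * x / (\<alpha> * p)"] by linarith
  then have "x \<le> (\<alpha> / c * p) * exp (c * x / (\<alpha> * p))"
    using assms ap by (simp add: field_simps)
  then have "x powr (\<alpha> * p) \<le> ((\<alpha> / c * p) * exp (c * x / (\<alpha> * p))) powr (\<alpha> * p)"
    using x ap by (intro powr_mono2) auto
  also have "\<dots> = (\<alpha> / c) powr (\<alpha> * p) * real p powr (\<alpha> * p) * exp (c * x)"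
    using assms False ap mult3[of "\<alpha> / c" "real p" "exp (c * x / (\<alpha> * p))"]
    by (simp add: exp_powr_real)
  also have "(\<alpha> / c) powr (\<alpha> * p) = ((\<alpha> / c) powr \<alpha>) ^ p"
    using assms by (simp add: powr_powr[symmetric] powr_realpow)
  finally have *: "x powr (\<alpha> * p) \<le> ((\<alpha> / c) powr \<alpha>) ^ p * real p powr (\<alpha> * p) * exp (c * x)" .
  have "x powr (\<alpha> * p) = real t ^ p"
    using assms False by (simp add: x_def powr_powr powr_realpow)
  with * have "real t ^ p * exp (- (c * x)) \<le> ((\<alpha> / c) powr \<alpha>) ^ p * real p powr (\<alpha> * p)"
    by (simp add: exp_minus field_simps)
  then show ?thesis using False by (simp add: x_def self_powr_def)
qed

lemma fact_ratio_ge: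
  fixes n p :: nat
  assumes "p \<le> n"
  shows "fact (n - p) * real (n - p) ^ p \<le> fact n"
  using assms
proof (induction p)
  case (Suc p)
  have "fact (n - p) = real (n - p) * fact (n - Suc p)"
    using Suc.prems by (metis Suc_diff_Suc Suc_le_lessD fact_Suc)
  then have "fact (n - Suc p) * real (n - Suc p) ^ Suc p
      \<le> fact (n - Suc p) * (real (n - p) * real (n - p) ^ p)"
    using Suc.prems by (auto intro!: mult_left_mono mult_mono power_mono)
  also have "\<dots> = fact (n - p) * real (n - p) ^ p"
    using \<open>fact (n - p) = _\<close> by simp
  also have "\<dots> \<le> fact n" using Suc by simp
  finally show ?case .
qed simp

text \<open>
  For $p \le n/2$ the quotient $n!/(n-p)!$ is at least $(n/2)^p$, so the left-hand side is at most
  $(2 A p^\alpha / n)^p$. Its base is at most $e^{-1}$ as soon as $p^\alpha \le n/K$ with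
  $K \ge 2Ae$, and the largest such $p$ is $\lfloor (n/K)^{1/\alpha} \rfloor$. Rounding down costs the
  factor $e$. The requirements $K \ge 2$ and $\alpha \ge 1$ guarantee $p \le n/2$.
\<close>

lemma optimal_derivative_order:
  fixes \<alpha> A :: real
  assumes "\<alpha> \<ge> 1" "A > 0"
  obtains c where "c > 0"
    "\<And>n. \<exists>p\<le>n. A ^ p * self_powr \<alpha> p * fact (n - p) / fact n
                 \<le> exp 1 * exp (- c * real n powr (1 / \<alpha>))"
proof
  define s where "s = 1 / \<alpha>"
  have s: "0 < s" "s \<le> 1" using assms by (auto simp: s_def)
  define K where "K = max 2 (2 * A * exp 1)"
  have K: "K \<ge> 2" "2 * A / K \<le> exp (- 1)" "K > 0"
    using assms by (auto simp: K_def exp_minus field_simps)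
  show "K powr - s > 0" using K by simp
  fix n :: nat
  show "\<exists>p\<le>n. A ^ p * self_powr \<alpha> p * fact (n - p) / fact n
                 \<le> exp 1 * exp (- (K powr - s) * real n powr (1 / \<alpha>))"
  proof -
    define y where "y = (real n / K) powr s"
    define p where "p = nat \<lfloor>y\<rfloor>"
    have y: "y = (K powr - s) * real n powr (1 / \<alpha>)"
      using K by (simp add: y_def powr_divide powr_minus s_def field_simps)
    have "y \<ge> 0" by (simp add: y_def)
    then have py: "real p \<le> y" "y < real p + 1"
      unfolding p_def by linarith+
    have pn: "2 * real p \<le> real n"
    proof (cases "real n / K < 1")
      case True
      then have "y \<le> 1" "n \<noteq> 0 \<Longrightarrow> y < 1" "n = 0 \<Longrightarrow> y = 0"
        using s K powr_less_mono2[of s "real n / K" 1] by (auto simp: y_def)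
      then have "p = 0" unfolding p_def using \<open>y \<ge> 0\<close> by (cases "n = 0") (auto intro: floor_eq_iff[THEN iffD2])
      then show ?thesis by simp
    next
      case False
      then have "y \<le> (real n / K) powr 1"
        unfolding y_def using s by (intro powr_mono) auto
      also have "\<dots> \<le> real n / 2" using K mult_left_mono[of 2 K "real n"] by (simp add: field_simps)
      finally show ?thesis using py by linarith
    qed
    have sp: "self_powr \<alpha> p \<le> (real n / K) ^ p"
    proof (cases "p = 0")
      case False
      have "real p powr \<alpha> \<le> y powr \<alpha>" using py assms by (intro powr_mono2) auto
      also have "\<dots> = real n / K"
        using assms K by (simp add: y_def s_def powr_powr)
      finally have "(real p powr \<alpha>) ^ p \<le> (real n / K) ^ p" by (intro power_mono) auto
      then show ?thesis using False by (simp add: self_powr_def powr_powr[symmetric] powr_realpow)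
    qed (simp add: self_powr_def)
    have fr: "fact (n - p) * (real n / 2) ^ p \<le> fact n"
    proof -
      have "fact (n - p) * (real n / 2) ^ p \<le> fact (n - p) * real (n - p) ^ p"
        using pn by (intro mult_left_mono power_mono) auto
      also have "\<dots> \<le> fact n" using pn by (intro fact_ratio_ge) linarith
      finally show ?thesis .
    qed
    have "A ^ p * self_powr \<alpha> p * fact (n - p) \<le> A ^ p * (real n / K) ^ p * fact (n - p)"
      using sp assms by (intro mult_right_mono mult_left_mono) auto
    also have "\<dots> = (2 * A / K) ^ p * (fact (n - p) * (real n / 2) ^ p)"
      by (simp add: power_divide power_mult_distrib)
    also have "\<dots> \<le> exp (- 1) ^ p * fact n"
      using K fr assms by (intro mult_mono power_mono) auto
    finally have "A ^ p * self_powr \<alpha> p * fact (n - p) / fact n \<le> exp (- 1) ^ p"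
      by (simp add: divide_le_eq)
    also have "\<dots> = exp (- real p)" by (simp add: exp_of_nat_mult[symmetric])
    also have "\<dots> \<le> exp (1 - y)" using py by simp
    also have "\<dots> = exp 1 * exp (- (K powr - s) * real n powr (1 / \<alpha>))"
      using y by (simp add: exp_diff exp_minus field_simps)
    finally show ?thesis using pn by (intro exI[of _ p]) auto
  qed
qed

section \<open>Sums of products over multi-indices\<close>

lemma finite_box: "finite {k :: nat ^ 'd::finite. \<forall>l. k $ l \<le> N l}"
proof (rule finite_imageD)
  show "inj_on vec_nth {k :: nat ^ 'd. \<forall>l. k $ l \<le> N l}"
    by (simp add: inj_on_def vec_eq_iff)
  have "vec_nth ` {k :: nat ^ 'd. \<forall>l. k $ l \<le> N l} \<subseteq> PiE UNIV (\<lambda>l. {..N l})"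
    by auto
  then show "finite (vec_nth ` {k :: nat ^ 'd. \<forall>l. k $ l \<le> N l})"
    by (rule finite_subset) (auto intro: finite_PiE)
qed

lemma sum_box_prod:
  fixes h :: "'d::finite \<Rightarrow> nat \<Rightarrow> 'a::comm_semiring_1"
  shows "(\<Sum>k\<in>{k :: nat ^ 'd. \<forall>l. k $ l \<le> N l}. \<Prod>l\<in>UNIV. h l (k $ l))
       = (\<Prod>l\<in>UNIV. \<Sum>j\<le>N l. h l j)"
proof -
  have "(\<Prod>l\<in>UNIV. \<Sum>j\<le>N l. h l j) = (\<Sum>f\<in>PiE UNIV (\<lambda>l. {..N l}). \<Prod>l\<in>UNIV. h l (f l))"
    by (rule prod_sum_PiE) auto
  also have "\<dots> = (\<Sum>k\<in>{k :: nat ^ 'd. \<forall>l. k $ l \<le> N l}. \<Prod>l\<in>UNIV. h l (k $ l))"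
    by (rule sum.reindex_bij_witness[of _ vec_nth vec_lambda]) (auto simp: vec_lambda_beta)
  finally show ?thesis ..
qed

text \<open>
  A finite set of multi-indices lies in a box, and over a box the sum of products is a product of
  partial sums.
\<close>

lemma multi_sum_prod:
  fixes h :: "'d::finite \<Rightarrow> nat \<Rightarrow> real"
  assumes nn: "\<And>l k. h l k \<ge> 0" and sm: "\<And>l. summable (h l)"
  shows "(\<lambda>m :: nat ^ 'd. \<Prod>l\<in>UNIV. h l (m $ l)) summable_on UNIV"
    and "(\<Sum>\<^sub>\<infinity>m :: nat ^ 'd. \<Prod>l\<in>UNIV. h l (m $ l)) \<le> (\<Prod>l\<in>UNIV. suminf (h l))"
proof -
  let ?P = "\<lambda>m :: nat ^ 'd. \<Prod>l\<in>UNIV. h l (m $ l)"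
  have bd: "sum ?P M \<le> (\<Prod>l\<in>UNIV. suminf (h l))" if "finite M" for M
  proof -
    define N where "N l = Max ((\<lambda>m. m $ l) ` M)" for l
    have "M \<subseteq> {k. \<forall>l. k $ l \<le> N l}"
      using that by (auto simp: N_def)
    then have "sum ?P M \<le> sum ?P {k. \<forall>l. k $ l \<le> N l}"
      by (intro sum_mono2 finite_box) (auto intro!: prod_nonneg nn)
    also have "\<dots> = (\<Prod>l\<in>UNIV. \<Sum>j\<le>N l. h l j)" by (rule sum_box_prod)
    also have "\<dots> \<le> (\<Prod>l\<in>UNIV. suminf (h l))"
      by (intro prod_mono conjI sum_nonneg nn sum_le_suminf sm) auto
    finally show ?thesis .
  qed
  show *: "?P summable_on UNIV"
    by (rule nonneg_bdd_above_summable_on) (use bd in \<open>auto intro!: prod_nonneg nn bdd_aboveI2\<close>)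
  show "infsum ?P UNIV \<le> (\<Prod>l\<in>UNIV. suminf (h l))"
    by (rule infsum_le_finite_sums[OF *]) (use bd in auto)
qed

section \<open>Power series on the polydisc\<close>

text \<open>
  Unconditional convergence of a complex series is absolute convergence, so this predicate allows the
  series to be regrouped and compared with majorants at every point of the polydisc.
\<close>

definition power_series_on_polydisc ::
    "(complex ^ 'd::finite \<Rightarrow> complex) \<Rightarrow> (nat ^ 'd \<Rightarrow> complex) \<Rightarrow> bool" where
  "power_series_on_polydisc G g \<longleftrightarrow>
     (\<forall>w\<in>unit_polydisc. ((\<lambda>m. g m * mi_power w m) has_sum G w) UNIV)"

definition with_coord :: "'a ^ 'd \<Rightarrow> 'd \<Rightarrow> 'a \<Rightarrow> 'a ^ 'd" where
  "with_coord w l z = (\<chi> j. if j = l then z else w $ j)"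

lemma with_coord_nth [simp]: "with_coord w l z $ j = (if j = l then z else w $ j)"
  by (simp add: with_coord_def)

lemma with_coord_same [simp]: "with_coord w l (w $ l) = w"
  by (simp add: vec_eq_iff)

lemma with_coord_polydisc:
  "w \<in> unit_polydisc \<Longrightarrow> cmod z < 1 \<Longrightarrow> with_coord w l z \<in> unit_polydisc"
  by (simp add: unit_polydisc_def)

lemma partial_deriv_with_coord: "partial_deriv l f w = deriv (\<lambda>z. f (with_coord w l z)) (w $ l)"
  by (simp add: partial_deriv_def with_coord_def)

lemma axis_nth: "axis l x $ j = (if j = l then x else 0)"
  by (simp add: axis_def)

lemma mi_power_split:
  "mi_power (w :: complex ^ 'd::finite) m = (w $ l) ^ (m $ l) * mi_power (with_coord w l 1) m"
proof -
  have "mi_power w m = (w $ l) ^ (m $ l) * (\<Prod>j\<in>UNIV - {l}. (w $ j) ^ (m $ j))"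
    unfolding mi_power_def by (rule prod.remove) auto
  also have "(\<Prod>j\<in>UNIV - {l}. (w $ j) ^ (m $ j)) = mi_power (with_coord w l 1) m"
    unfolding mi_power_def by (subst prod.remove[of UNIV l]) auto
  finally show ?thesis .
qed

lemma mi_power_with_coord:
  "mi_power (with_coord w l z) m = z ^ (m $ l) * mi_power (with_coord (w :: complex ^ 'd::finite) l 1) m"
proof -
  have "with_coord (with_coord w l z) l 1 = with_coord w l 1" by (simp add: vec_eq_iff)
  then show ?thesis using mi_power_split[of "with_coord w l z" m l] by simp
qed

lemma mi_power_add: "mi_power w (m + n) = mi_power w m * mi_power w n"
  by (simp add: mi_power_def power_add prod.distrib)

lemma mi_power_axis [simp]: "mi_power (w :: complex ^ 'd::finite) (axis l k) = (w $ l) ^ k"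
proof -
  have "mi_power w (axis l k) = (\<Prod>j\<in>UNIV. if j = l then (w $ l) ^ k else 1)"
    unfolding mi_power_def by (intro prod.cong) (auto simp: axis_nth)
  then show ?thesis by simp
qed

lemma mi_power_with_coord_axis: "mi_power (with_coord (w :: complex ^ 'd::finite) l 1) (m + axis l k) = mi_power (with_coord w l 1) m"
  by (simp add: mi_power_add)

lemma mi_size_axis [simp]: "mi_size (axis l k :: nat ^ 'd::finite) = k"
  by (simp add: mi_size_def axis_nth)

lemma mi_size_add: "mi_size (m + n) = mi_size m + mi_size n"
  by (simp add: mi_size_def sum.distrib)

lemma norm_mi_power: "cmod (mi_power w m) = (\<Prod>l\<in>UNIV. cmod (w $ l) ^ (m $ l))"
  by (simp add: mi_power_def prod_norm[symmetric] norm_power)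

lemma power_series_abs:
  assumes "power_series_on_polydisc G g" "w \<in> unit_polydisc"
  shows "(\<lambda>m. cmod (g m * mi_power w m)) summable_on UNIV"
  using assms unfolding power_series_on_polydisc_def
  by (auto simp: summable_on_iff_abs_summable_on_complex[symmetric] has_sum_imp_summable)

lemma power_series_bounded_coeff:
  fixes g :: "nat ^ 'd::finite \<Rightarrow> complex"
  assumes "\<And>m. cmod (g m) \<le> B" "w \<in> unit_polydisc"
  shows "(\<lambda>m. g m * mi_power w m) summable_on UNIV"
proof -
  have "(\<lambda>m :: nat ^ 'd. \<Prod>l\<in>UNIV. cmod (w $ l) ^ (m $ l)) summable_on UNIV"
    using assms(2) by (intro multi_sum_prod) (auto simp: unit_polydisc_def)
  then have "(\<lambda>m :: nat ^ 'd. B * (\<Prod>l\<in>UNIV. cmod (w $ l) ^ (m $ l))) summable_on UNIV"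
    by (rule summable_on_cmult_right)
  then show ?thesis
    unfolding summable_on_iff_abs_summable_on_complex
    by (rule Infinite_Sum.abs_summable_on_comparison_test')
       (auto simp: norm_mult norm_mi_power intro!: mult_right_mono assms prod_nonneg)
qed

section \<open>Slicing along one coordinate\<close>

lemma bij_add_axis:
  "bij_betw (\<lambda>m :: nat ^ 'd::finite. m + axis l 1) {m. m $ l = k} {m. m $ l = Suc k}"
  by (rule bij_betw_byWitness[of _ "\<lambda>m. m - axis l 1"]) (auto simp: vec_eq_iff axis_nth)

lemma bij_add_axis_UNIV:
  "bij_betw (\<lambda>m :: nat ^ 'd::finite. m + axis l 1) UNIV {m. m $ l \<noteq> 0}"
  by (rule bij_betw_byWitness[of _ "\<lambda>m. m - axis l 1"]) (auto simp: vec_eq_iff axis_nth)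

text \<open>
  The coefficient of $z^k$ when all coordinates of $w$ except the $l$-th are fixed and the $l$-th is
  the variable $z$. Setting the $l$-th coordinate to $1$ removes its factor from the monomial, so the
  coefficient is independent of \<open>w $ l\<close>.
\<close>

definition slice_coeff ::
    "(nat ^ 'd::finite \<Rightarrow> complex) \<Rightarrow> complex ^ 'd \<Rightarrow> 'd \<Rightarrow> nat \<Rightarrow> complex" where
  "slice_coeff g w l k = (\<Sum>\<^sub>\<infinity>m\<in>{m. m $ l = k}. g m * mi_power (with_coord w l 1) m)"

lemma slice_sums:
  fixes w :: "complex ^ 'd::finite"
  assumes "((\<lambda>m. g m * mi_power (with_coord w l z) m) has_sum S) UNIV"
  shows "(\<lambda>k. slice_coeff g w l k * z ^ k) sums S"
proof (rule has_sum_imp_sums)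
  let ?f = "\<lambda>m. g m * mi_power (with_coord w l z) m"
  have "bij_betw (snd :: nat \<times> (nat ^ 'd) \<Rightarrow> _) (Sigma UNIV (\<lambda>k. {m. m $ l = k})) UNIV"
    by (rule bij_betw_byWitness[of _ "\<lambda>m. (m $ l, m)"]) auto
  then have *: "((\<lambda>x. ?f (snd x)) has_sum S) (Sigma UNIV (\<lambda>k. {m. m $ l = k}))"
    using assms has_sum_reindex_bij_betw[of snd _ UNIV ?f S] by blast
  show "((\<lambda>k. slice_coeff g w l k * z ^ k) has_sum S) UNIV"
  proof (rule has_sum_SigmaD[OF *])
    fix k
    have "?f summable_on {m. m $ l = k}"
      using assms by (meson has_sum_imp_summable subset_UNIV summable_on_subset_banach)
    then have "(?f has_sum infsum ?f {m. m $ l = k}) {m. m $ l = k}" by simp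
    moreover have "infsum ?f {m. m $ l = k} = slice_coeff g w l k * z ^ k"
      unfolding slice_coeff_def infsum_cmult_left'[symmetric]
      by (rule infsum_cong) (simp add: mi_power_with_coord[of w l z])
    ultimately show "((\<lambda>m. ?f (snd (k, m))) has_sum slice_coeff g w l k * z ^ k) {m. m $ l = k}"
      by simp
  qed
qed

lemma power_series_slice:
  assumes "power_series_on_polydisc G g" "w \<in> unit_polydisc" "cmod z < 1"
  shows "(\<lambda>k. slice_coeff g w l k * z ^ k) sums G (with_coord w l z)"
  using assms by (intro slice_sums) (auto simp: power_series_on_polydisc_def with_coord_polydisc)

section \<open>The Cauchy estimate on the polydisc\<close>

text \<open>
  The classical Cauchy inequality on circles of radius $r < 1$, in the limit $r \to 1$; this limit is
  what removes all dependence on the radius.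
\<close>

lemma power_series_coeff_le:
  fixes c :: "nat \<Rightarrow> complex"
  assumes sums: "\<And>z. cmod z < 1 \<Longrightarrow> (\<lambda>k. c k * z ^ k) sums H z"
    and bound: "\<And>z. cmod z < 1 \<Longrightarrow> cmod (H z) \<le> B"
  shows "cmod (c k) \<le> B"
proof -
  have hol: "H holomorphic_on ball 0 1"
    by (rule power_series_holomorphic[of 0 1 c]) (use sums in auto)
  have der: "(deriv ^^ k) H 0 = fact k * c k"
  proof -
    have "H has_fps_expansion Abs_fps c"
      using eventually_nhds_in_open[of "ball 0 1" "0 :: complex"]
      by (intro has_fps_expansionI) (auto elim!: eventually_mono intro: sums)
    from fps_nth_fps_expansion[OF this, of k] show ?thesis by (simp add: field_simps)
  qed
  have le: "cmod (c k) * r ^ k \<le> B" if r: "0 < r" "r < 1" for r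
  proof -
    have "cmod ((deriv ^^ k) H 0) \<le> fact k * B / r ^ k"
    proof (rule Cauchy_inequality)
      show "continuous_on (cball 0 r) H"
        using hol r by (intro holomorphic_on_imp_continuous_on) (auto elim!: holomorphic_on_subset)
    qed (use hol r bound in \<open>auto elim!: holomorphic_on_subset\<close>)
    then show ?thesis using r by (simp add: der norm_mult field_simps)
  qed
  have "((\<lambda>r. cmod (c k) * r ^ k) \<longlongrightarrow> cmod (c k) * 1 ^ k) (at_left 1)"
    by (intro tendsto_intros)
  moreover have "eventually (\<lambda>r::real. r \<in> {0<..<1}) (at_left 1)"
    by (rule eventually_at_left_real) simp
  then have "eventually (\<lambda>r. cmod (c k) * r ^ k \<le> B) (at_left (1::real))"
    by eventually_elim (use le in auto)
  ultimately show ?thesis using tendsto_upperbound by fastforce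
qed

text \<open>
  Keeping only the monomials with exponent $k$ in the $l$-th coordinate preserves the bound: the
  restricted series is $w_l^k$ times a slice coefficient, which the one-variable Cauchy estimate bounds
  by $B$. In this form the step can be repeated for the other coordinates.
\<close>

lemma power_series_restrict:
  assumes G: "power_series_on_polydisc G g"
    and B: "\<And>w. w \<in> unit_polydisc \<Longrightarrow> cmod (G w) \<le> B"
  obtains H where "power_series_on_polydisc H (\<lambda>m. if m $ l = k then g m else 0)"
    and "\<And>w. w \<in> unit_polydisc \<Longrightarrow> cmod (H w) \<le> B"
proof
  let ?H = "\<lambda>w. slice_coeff g w l k * (w $ l) ^ k"
  show "power_series_on_polydisc ?H (\<lambda>m. if m $ l = k then g m else 0)"
    unfolding power_series_on_polydisc_def
  proof
    fix w :: "complex ^ 'a" assume w: "w \<in> unit_polydisc"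
    let ?f = "\<lambda>m. g m * mi_power w m"
    have "?f summable_on UNIV"
      using G w by (auto simp: power_series_on_polydisc_def has_sum_imp_summable)
    then have "?f summable_on {m. m $ l = k}"
      by (rule summable_on_subset_banach) simp
    then have "(?f has_sum infsum ?f {m. m $ l = k}) {m. m $ l = k}" by simp
    moreover have "infsum ?f {m. m $ l = k} = ?H w"
      unfolding slice_coeff_def infsum_cmult_left'[symmetric]
      by (rule infsum_cong) (simp add: mi_power_split[where w = w and l = l] del: with_coord_nth)
    ultimately show "((\<lambda>m. (if m $ l = k then g m else 0) * mi_power w m) has_sum ?H w) UNIV"
      by (subst has_sum_cong_neutral[where T = "{m. m $ l = k}" and g = ?f]) auto
  qed
  fix w :: "complex ^ 'a" assume w: "w \<in> unit_polydisc"
  have "cmod (slice_coeff g w l k) \<le> B"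
    by (rule power_series_coeff_le[OF power_series_slice[OF G w]]) (use w B with_coord_polydisc in auto)
  moreover have "cmod (w $ l) ^ k \<le> 1" using w by (simp add: unit_polydisc_def power_le_one less_imp_le)
  ultimately show "cmod (?H w) \<le> B"
    using mult_mono[of "cmod (slice_coeff g w l k)" B "cmod (w $ l) ^ k" 1]
    by (simp add: norm_mult norm_power order.trans[OF norm_ge_zero])
qed

text \<open>
  Restricting the series in all coordinates leaves the single term $g_n w^n$, still bounded by $B$ on
  the polydisc; now let $w \to (1, \dots, 1)$.
\<close>

theorem Cauchy_estimate_polydisc:
  fixes g :: "nat ^ 'd::finite \<Rightarrow> complex"
  assumes G: "power_series_on_polydisc G g"
    and B: "\<And>w. w \<in> unit_polydisc \<Longrightarrow> cmod (G w) \<le> B"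
  shows "cmod (g n) \<le> B"
proof -
  have "\<exists>H. power_series_on_polydisc H (\<lambda>m. if \<forall>l\<in>I. m $ l = n $ l then g m else 0) \<and>
          (\<forall>w\<in>unit_polydisc. cmod (H w) \<le> B)" if "finite I" for I
    using that
  proof (induction I)
    case empty
    show ?case using G B by auto
  next
    case (insert l I)
    then obtain H where H: "power_series_on_polydisc H (\<lambda>m. if \<forall>l\<in>I. m $ l = n $ l then g m else 0)"
      "\<And>w. w \<in> unit_polydisc \<Longrightarrow> cmod (H w) \<le> B" by blast
    have eq: "(\<lambda>m. if m $ l = n $ l then if \<forall>l\<in>I. m $ l = n $ l then g m else 0 else 0)
        = (\<lambda>m. if \<forall>l\<in>insert l I. m $ l = n $ l then g m else 0)" by auto
    show ?case
      by (rule power_series_restrict[OF H, of l "n $ l"]) (auto simp: eq)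
  qed
  from this[of UNIV] obtain H
    where H: "power_series_on_polydisc H (\<lambda>m. if m = n then g m else 0)"
      "\<And>w. w \<in> unit_polydisc \<Longrightarrow> cmod (H w) \<le> B"
    by (auto simp: vec_eq_iff)
  have Hw: "H w = g n * mi_power w n" if "w \<in> unit_polydisc" for w
  proof -
    have "((\<lambda>m. (if m = n then g m else 0) * mi_power w m) has_sum H w) UNIV"
      using H(1) that by (simp add: power_series_on_polydisc_def)
    moreover have "((\<lambda>m. (if m = n then g m else 0) * mi_power w m) has_sum g n * mi_power w n) UNIV"
      by (rule has_sum_finite_neutralI[of "{n}"]) auto
    ultimately show ?thesis by (rule has_sum_unique)
  qed
  have le: "cmod (g n) * (\<Prod>l\<in>UNIV. r ^ (n $ l)) \<le> B" if r: "0 < r" "r < 1" for r :: real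
  proof -
    let ?w = "(\<chi> l. complex_of_real r) :: complex ^ 'd"
    have w: "?w \<in> unit_polydisc" using r by (simp add: unit_polydisc_def)
    show ?thesis using H(2)[OF w] r by (simp add: Hw[OF w] norm_mult norm_mi_power)
  qed
  have "((\<lambda>r. cmod (g n) * (\<Prod>l\<in>UNIV. r ^ (n $ l))) \<longlongrightarrow> cmod (g n) * (\<Prod>l\<in>UNIV. 1 ^ (n $ l))) (at_left 1)"
    by (intro tendsto_intros)
  moreover have "eventually (\<lambda>r::real. r \<in> {0<..<1}) (at_left 1)"
    by (rule eventually_at_left_real) simp
  then have "eventually (\<lambda>r. cmod (g n) * (\<Prod>l\<in>UNIV. r ^ (n $ l)) \<le> B) (at_left (1::real))"
    by eventually_elim (use le in auto)
  ultimately show ?thesis using tendsto_upperbound by fastforce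
qed

section \<open>Multiplication by one minus a coordinate\<close>

text \<open>
  Coefficients with a negative index count as $0$. The case distinction is needed because subtraction
  of natural numbers is truncated.
\<close>

definition backward_diff :: "'d::finite \<Rightarrow> (nat ^ 'd \<Rightarrow> complex) \<Rightarrow> nat ^ 'd \<Rightarrow> complex" where
  "backward_diff l g m = g m - (if m $ l = 0 then 0 else g (m - axis l 1))"

lemma backward_diff_add_axis: "backward_diff l g (m + axis l (Suc k)) = g (m + axis l (Suc k)) - g (m + axis l k)"
proof -
  have "m + axis l (Suc k) - axis l 1 = m + axis l k" by (auto simp: vec_eq_iff axis_nth)
  then show ?thesis by (simp add: backward_diff_def axis_nth)
qed

lemma power_series_mult_one_minus:
  assumes "power_series_on_polydisc G g"
  shows "power_series_on_polydisc (\<lambda>w. (1 - w $ l) * G w) (backward_diff l g)"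
  unfolding power_series_on_polydisc_def
proof
  fix w :: "complex ^ 'a" assume "w \<in> unit_polydisc"
  then have *: "((\<lambda>m. g m * mi_power w m) has_sum G w) UNIV"
    using assms by (simp add: power_series_on_polydisc_def)
  let ?h = "\<lambda>m. (if m $ l = 0 then 0 else g (m - axis l 1)) * mi_power w m"
  have "((\<lambda>m. w $ l * (g m * mi_power w m)) has_sum w $ l * G w) UNIV"
    using * by (rule has_sum_cmult_right)
  also have "(\<lambda>m. w $ l * (g m * mi_power w m)) = (\<lambda>m. ?h (m + axis l 1))"
  proof
    fix m :: "nat ^ 'a"
    have "m + axis l 1 - axis l 1 = m" by (auto simp: vec_eq_iff axis_nth)
    then show "w $ l * (g m * mi_power w m) = ?h (m + axis l 1)"
      by (simp add: axis_nth mi_power_add)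
  qed
  finally have "(?h has_sum w $ l * G w) {m. m $ l \<noteq> 0}"
    using has_sum_reindex_bij_betw[OF bij_add_axis_UNIV[of l], of ?h] by simp
  then have "(?h has_sum w $ l * G w) UNIV"
    by (subst has_sum_cong_neutral[of "{m. m $ l \<noteq> 0}" UNIV ?h ?h]) auto
  from has_sum_add[OF * has_sum_uminusI[OF this]]
  show "((\<lambda>m. backward_diff l g m * mi_power w m) has_sum (1 - w $ l) * G w) UNIV"
    by (simp add: backward_diff_def algebra_simps)
qed

section \<open>Termwise differentiation\<close>

definition coeff_deriv :: "'d::finite \<Rightarrow> (nat ^ 'd \<Rightarrow> complex) \<Rightarrow> nat ^ 'd \<Rightarrow> complex" where
  "coeff_deriv l g m = of_nat (Suc (m $ l)) * g (m + axis l 1)"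

text \<open>
  The factor $k + 1$ produced by differentiation is absorbed by passing to a slightly larger radius.
\<close>

lemma Suc_times_power_bounded:
  fixes x y :: real
  assumes "0 \<le> x" "x < y"
  obtains M where "M > 0" "\<And>k. real (Suc k) * x ^ k \<le> M * y ^ Suc k"
proof -
  have y: "y > 0" using assms by simp
  have "(\<lambda>k. real k * (x / y) ^ k) \<longlonglongrightarrow> 0"
    using assms y by (intro powser_times_n_limit_0) auto
  moreover have "(\<lambda>k. (x / y) ^ k) \<longlonglongrightarrow> 0"
    using assms y by (intro LIMSEQ_realpow_zero) auto
  ultimately have "(\<lambda>k. real k * (x / y) ^ k + (x / y) ^ k) \<longlonglongrightarrow> 0 + 0" by (rule tendsto_add)
  then have "Bseq (\<lambda>k. real (Suc k) * (x / y) ^ k)"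
    by (intro convergent_imp_Bseq convergentI) (auto simp: algebra_simps)
  then obtain M where M: "M > 0" "\<And>k. norm (real (Suc k) * (x / y) ^ k) \<le> M"
    by (auto elim!: BseqE)
  show ?thesis
  proof
    show "M / y > 0" using M y by simp
    fix k
    have "real (Suc k) * (x / y) ^ k \<le> M" using M(2)[of k] by (simp only: real_norm_def abs_le_iff)
    then show "real (Suc k) * x ^ k \<le> M / y * y ^ Suc k"
      using y by (simp add: power_divide field_simps)
  qed
qed

text \<open>
  Differentiating in the $l$-th coordinate is differentiating the one-variable power series of slice
  coefficients, and the slice coefficients of the differentiated family are those of the derivative.
  Absolute convergence at $w$ follows from that of the original series at the point where $w_l$ is
  replaced by some $r$ with $|w_l| < r < 1$.
\<close>

lemma power_series_partial_deriv:
  fixes g :: "nat ^ 'd::finite \<Rightarrow> complex"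
  assumes G: "power_series_on_polydisc G g"
  shows "power_series_on_polydisc (partial_deriv l G) (coeff_deriv l g)"
  unfolding power_series_on_polydisc_def
proof
  fix w :: "complex ^ 'd" assume w: "w \<in> unit_polydisc"
  let ?f = "\<lambda>m. coeff_deriv l g m * mi_power w m"
  have wl: "cmod (w $ l) < 1" using w by (simp add: unit_polydisc_def)
  have summ: "?f summable_on UNIV"
  proof -
    obtain r where r: "cmod (w $ l) < r" "r < 1" using wl dense by blast
    then have r0: "r > 0" using norm_ge_zero[of "w $ l"] by linarith
    obtain M where M: "M > 0" "\<And>k. real (Suc k) * cmod (w $ l) ^ k \<le> M * r ^ Suc k"
      using Suc_times_power_bounded[OF norm_ge_zero r(1)] by blast
    let ?v = "with_coord w l (of_real r)"
    have "(\<lambda>m. cmod (g m * mi_power ?v m)) summable_on UNIV"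
      using r r0 w by (intro power_series_abs[OF G] with_coord_polydisc) auto
    then have "(\<lambda>m. cmod (g m * mi_power ?v m)) summable_on {m. m $ l \<noteq> 0}"
      by (rule summable_on_subset_banach) auto
    then have "(\<lambda>m. norm (g (m + axis l 1) * mi_power ?v (m + axis l 1))) summable_on UNIV"
      using summable_on_reindex_bij_betw[OF bij_add_axis_UNIV[of l],
          of "\<lambda>m. norm (g m * mi_power ?v m)"] by simp
    then have "(\<lambda>m. M * norm (g (m + axis l 1) * mi_power ?v (m + axis l 1))) summable_on UNIV"
      by (rule summable_on_cmult_right)
    then show ?thesis
      unfolding summable_on_iff_abs_summable_on_complex
    proof (rule Infinite_Sum.abs_summable_on_comparison_test')
      fix m :: "nat ^ 'd"
      let ?Q = "cmod (g (m + axis l 1)) * cmod (mi_power (with_coord w l 1) m)"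
      have "norm (?f m) = (real (Suc (m $ l)) * cmod (w $ l) ^ (m $ l)) * ?Q"
        by (simp only: coeff_deriv_def mi_power_split[of w m l] norm_mult norm_power norm_of_nat) simp
      also have "\<dots> \<le> (M * r ^ Suc (m $ l)) * ?Q"
        by (intro mult_right_mono M) auto
      also have "\<dots> = M * norm (g (m + axis l 1) * mi_power ?v (m + axis l 1))"
        using r0 by (simp add: mi_power_with_coord[of w l "of_real r"] mi_power_with_coord_axis axis_nth norm_mult norm_power)
      finally show "norm (?f m) \<le> M * norm (g (m + axis l 1) * mi_power ?v (m + axis l 1))" .
    qed
  qed
  have slice: "slice_coeff (coeff_deriv l g) w l k = diffs (slice_coeff g w l) k" for k
  proof -
    have "slice_coeff g w l (Suc k)
        = (\<Sum>\<^sub>\<infinity>m\<in>{m. m $ l = k}. g (m + axis l 1) * mi_power (with_coord w l 1) (m + axis l 1))"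
      unfolding slice_coeff_def by (rule infsum_reindex_bij_betw[OF bij_add_axis, symmetric])
    then have "diffs (slice_coeff g w l) k
        = (\<Sum>\<^sub>\<infinity>m\<in>{m. m $ l = k}. of_nat (Suc k) * (g (m + axis l 1) * mi_power (with_coord w l 1) (m + axis l 1)))"
      by (simp only: diffs_def infsum_cmult_right')
    also have "\<dots> = slice_coeff (coeff_deriv l g) w l k"
      unfolding slice_coeff_def
      by (rule infsum_cong) (simp add: coeff_deriv_def mi_power_with_coord_axis mult.assoc)
    finally show ?thesis ..
  qed
  have "(\<lambda>k. slice_coeff (coeff_deriv l g) w l k * (w $ l) ^ k) sums infsum ?f UNIV"
    by (rule slice_sums) (use summ in simp)
  then have 1: "(\<Sum>k. diffs (slice_coeff g w l) k * (w $ l) ^ k) = infsum ?f UNIV"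
    by (simp add: slice sums_iff)
  have "(\<lambda>z. G (with_coord w l z)) holomorphic_on ball 0 1"
    by (rule power_series_holomorphic[of 0 1 "slice_coeff g w l"])
       (use power_series_slice[OF G w] in auto)
  then have "((\<lambda>z. G (with_coord w l z)) has_field_derivative partial_deriv l G w) (at (w $ l))"
    unfolding partial_deriv_with_coord using wl by (intro holomorphic_derivI[of _ "ball 0 1"]) auto
  then have "(\<lambda>k. diffs (slice_coeff g w l) k * (w $ l) ^ k) sums partial_deriv l G w"
    by (rule termdiffs_sums_strong[of 1, rotated]) (use power_series_slice[OF G w] wl in auto)
  then have "partial_deriv l G w = infsum ?f UNIV"
    using 1 by (simp add: sums_iff)
  then show "(?f has_sum partial_deriv l G w) UNIV" using summ by simp
qed

lemma coeff_deriv_funpow: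
  "(coeff_deriv l ^^ k) g m = of_real (fact (m $ l + k) / fact (m $ l)) * g (m + axis l k)"
proof (induction k arbitrary: m)
  case 0
  have "m + axis l 0 = m" by (auto simp: vec_eq_iff axis_nth)
  then show ?case by (simp only: funpow_0 add_0_right) simp
next
  case (Suc k)
  have "m + axis l 1 + axis l k = m + axis l (Suc k)" by (auto simp: vec_eq_iff axis_nth)
  have ratio: "complex_of_real (fact (m $ l + Suc k) / fact (m $ l))
      = of_nat (Suc (m $ l)) * of_real (fact (Suc (m $ l) + k) / fact (Suc (m $ l)))"
  proof -
    have "fact (m $ l + Suc k) / fact (m $ l)
        = real (Suc (m $ l)) * (fact (Suc (m $ l) + k) / fact (Suc (m $ l)))"
      by (simp only: fact_Suc[of "m $ l"] add_Suc_right add_Suc) (simp del: fact_Suc of_nat_Suc)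
    then show ?thesis by (metis of_real_mult of_real_of_nat_eq)
  qed
  have "(coeff_deriv l ^^ Suc k) g m
      = of_nat (Suc (m $ l)) * (of_real (fact (Suc (m $ l) + k) / fact (Suc (m $ l)))
          * g (m + axis l 1 + axis l k))"
    by (simp add: coeff_deriv_def Suc axis_nth)
  also have "\<dots> = of_real (fact (m $ l + Suc k) / fact (m $ l)) * g (m + axis l (Suc k))"
    unfolding ratio \<open>m + axis l 1 + axis l k = _\<close> by (rule mult.assoc[symmetric])
  finally show ?case .
qed

lemma power_series_partial_deriv_funpow:
  "power_series_on_polydisc G g \<Longrightarrow>
   power_series_on_polydisc ((partial_deriv l ^^ k) G) ((coeff_deriv l ^^ k) g)"
  by (induction k) (auto intro: power_series_partial_deriv)

text \<open>
  Each coordinate occurs once in the list of directions, so the factorial quotients of one direction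
  are unaffected by the shifts in the others.
\<close>

lemma power_series_mixed_deriv:
  fixes g :: "nat ^ 'd::{finite,linorder} \<Rightarrow> complex"
  assumes "power_series_on_polydisc G g"
  shows "power_series_on_polydisc (mixed_deriv p G)
    (\<lambda>m. of_real (\<Prod>l\<in>UNIV. fact (m $ l + p $ l) / fact (m $ l)) * g (m + p))"
proof -
  \<comment> \<open>The coefficients after differentiating only in the directions listed in \<open>ls\<close>.\<close>
  let ?c = "\<lambda>ls m. of_real (\<Prod>l\<in>set ls. fact (m $ l + p $ l) / fact (m $ l))
               * g (\<chi> l. m $ l + (if l \<in> set ls then p $ l else 0))"
  have "power_series_on_polydisc (foldr (\<lambda>l. partial_deriv l ^^ (p $ l)) ls G) (?c ls)"
    if "distinct ls" for ls
    using that
  proof (induction ls)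
    case Nil
    then show ?case using assms by simp
  next
    case (Cons l ls)
    have "(coeff_deriv l ^^ (p $ l)) (?c ls) m = ?c (l # ls) m" for m
    proof -
      have "(\<Prod>j\<in>set ls. fact ((m + axis l (p $ l)) $ j + p $ j) / fact ((m + axis l (p $ l)) $ j))
          = (\<Prod>j\<in>set ls. fact (m $ j + p $ j) / fact (m $ j) :: real)"
        using Cons.prems by (intro prod.cong) (auto simp: axis_nth)
      moreover have "(\<chi> j. (m + axis l (p $ l)) $ j + (if j \<in> set ls then p $ j else 0))
          = (\<chi> j. m $ j + (if j \<in> set (l # ls) then p $ j else 0))"
        using Cons.prems by (auto simp: vec_eq_iff axis_nth)
      ultimately show ?thesis
        using Cons.prems by (simp only: coeff_deriv_funpow) simp
    qed
    then have eq: "(coeff_deriv l ^^ (p $ l)) (?c ls) = ?c (l # ls)" by (rule ext)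
    have "power_series_on_polydisc ((partial_deriv l ^^ (p $ l))
            (foldr (\<lambda>l. partial_deriv l ^^ (p $ l)) ls G)) ((coeff_deriv l ^^ (p $ l)) (?c ls))"
      using Cons by (intro power_series_partial_deriv_funpow) auto
    then show ?case by (simp only: eq foldr_Cons o_apply)
  qed
  from this[of "sorted_list_of_set UNIV"]
  show ?thesis by (simp add: mixed_deriv_def plus_vec_def)
qed

section \<open>Recentring a power series\<close>

lemma mi_power_add_binomial:
  fixes z h :: "complex ^ 'd::finite"
  shows "((\<lambda>k. (\<Prod>l\<in>UNIV. of_nat (m $ l choose k $ l) * (z $ l) ^ (m $ l - k $ l)) * mi_power h k)
           has_sum mi_power (z + h) m) UNIV"
proof (rule has_sum_finite_neutralI[of "{k. \<forall>l. k $ l \<le> m $ l}"])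
  let ?t = "\<lambda>l j. of_nat (m $ l choose j) * (z $ l) ^ (m $ l - j) * (h $ l) ^ j"
  have "mi_power (z + h) m = (\<Prod>l\<in>UNIV. \<Sum>j\<le>m $ l. ?t l j)"
    unfolding mi_power_def
    by (intro prod.cong refl) (simp add: add.commute[of "z $ _"] binomial_ring mult_ac)
  also have "\<dots> = (\<Sum>k\<in>{k :: nat ^ 'd. \<forall>l. k $ l \<le> m $ l}. \<Prod>l\<in>UNIV. ?t l (k $ l))"
    by (rule sum_box_prod[symmetric])
  finally show "mi_power (z + h) m = (\<Sum>k\<in>{k :: nat ^ 'd. \<forall>l. k $ l \<le> m $ l}.
      (\<Prod>l\<in>UNIV. of_nat (m $ l choose k $ l) * (z $ l) ^ (m $ l - k $ l)) * mi_power h k)"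
    by (simp add: mi_power_def prod.distrib)
next
  fix k :: "nat ^ 'd" assume "k \<in> UNIV - {k. \<forall>l. k $ l \<le> m $ l}"
  then obtain l where "m $ l < k $ l" by (auto simp: not_le)
  then have "m $ l choose k $ l = 0" by simp
  then have "\<exists>l. of_nat (m $ l choose k $ l) * (z $ l) ^ (m $ l - k $ l) = 0"
    by (metis mult_zero_left of_nat_0)
  then show "(\<Prod>l\<in>UNIV. of_nat (m $ l choose k $ l) * (z $ l) ^ (m $ l - k $ l)) * mi_power h k = 0"
    by (subst mult_eq_0_iff, subst prod_zero_iff) auto
qed (auto intro: finite_box)

text \<open>
  Expand each $(z + h)^m$ binomially and sum over $m$ first. The double series converges absolutely
  because its absolute values sum over $k$ to the terms $|g_m| \prod_l (|z_l| + |h_l|)^{m_l}$ of the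
  original series at another point of the polydisc.
\<close>

lemma power_series_imp_analytic:
  fixes g :: "nat ^ 'd::finite \<Rightarrow> complex"
  assumes G: "power_series_on_polydisc G g"
  shows "multi_analytic_on G unit_polydisc"
  unfolding multi_analytic_on_def
proof
  fix z :: "complex ^ 'd" assume z: "z \<in> unit_polydisc"
  define B where "B m k = (\<Prod>l\<in>UNIV. of_nat (m $ l choose k $ l) * (z $ l) ^ (m $ l - k $ l))"
    for m k :: "nat ^ 'd"
  define c where "c k = (\<Sum>\<^sub>\<infinity>m. g m * B m k)" for k
  define r where "r = Min (range (\<lambda>l. 1 - cmod (z $ l)))"
  have "r > 0" using z by (auto simp: r_def unit_polydisc_def)
  moreover have "((\<lambda>k. c k * mi_power (w - z) k) has_sum G w) UNIV"
    if w: "\<forall>l. cmod (w $ l - z $ l) < r" for w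
  proof -
    define h where "h = w - z"
    have zh: "z + h = w" by (simp add: h_def)
    have bd: "cmod (z $ l) + cmod (h $ l) < 1" for l
    proof -
      have "r \<le> 1 - cmod (z $ l)" unfolding r_def by (rule Min_le) auto
      moreover have "cmod (h $ l) < r" using w by (simp add: h_def)
      ultimately show ?thesis by linarith
    qed
    have "cmod (w $ l) < 1" for l
      using bd[of l] norm_triangle_ineq[of "z $ l" "h $ l"] by (simp add: zh[symmetric])
    then have wD: "w \<in> unit_polydisc" by (simp add: unit_polydisc_def)
    define T where "T = (\<lambda>(m, k). g m * (B m k * mi_power h k))"
    let ?z = "(\<chi> l. of_real (cmod (z $ l))) :: complex ^ 'd"
    let ?h = "(\<chi> l. of_real (cmod (h $ l))) :: complex ^ 'd"
    have vD: "?z + ?h \<in> unit_polydisc"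
      using bd by (simp add: unit_polydisc_def flip: of_real_add)
    have normT: "((\<lambda>k. cmod (T (m, k))) has_sum cmod (g m * mi_power (?z + ?h) m)) UNIV" for m
    proof -
      have "((\<lambda>k. complex_of_real (cmod (B m k * mi_power h k))) has_sum mi_power (?z + ?h) m) UNIV"
      proof -
        have "complex_of_real (cmod (B m k * mi_power h k))
            = (\<Prod>l\<in>UNIV. of_nat (m $ l choose k $ l) * (?z $ l) ^ (m $ l - k $ l)) * mi_power ?h k" for k
          unfolding B_def mi_power_def norm_mult prod_norm[symmetric] norm_power norm_of_nat by simp
        then show ?thesis using mi_power_add_binomial[of m ?z ?h] by simp
      qed
      moreover have R: "complex_of_real (cmod (mi_power (?z + ?h) m)) = mi_power (?z + ?h) m"
        by (simp add: mi_power_def prod_norm[symmetric] norm_power flip: of_real_add)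
      ultimately have "((\<lambda>k. complex_of_real (cmod (B m k * mi_power h k)))
          has_sum complex_of_real (cmod (mi_power (?z + ?h) m))) UNIV"
        unfolding R by blast
      then have "((\<lambda>k. cmod (B m k * mi_power h k)) has_sum cmod (mi_power (?z + ?h) m)) UNIV"
        by (simp only: has_sum_of_real_iff)
      then show ?thesis unfolding T_def
        by (simp add: norm_mult[of "g m"] has_sum_cmult_right)
    qed
    have "(\<lambda>x. cmod (T x)) summable_on (Sigma UNIV (\<lambda>_. UNIV))"
      by (rule summable_on_SigmaI[OF normT power_series_abs[OF G vD]]) auto
    then have "T summable_on UNIV \<times> UNIV"
      by (simp add: summable_on_iff_abs_summable_on_complex)
    moreover have "((\<lambda>k. T (m, k)) has_sum g m * mi_power w m) UNIV" for m
      using has_sum_cmult_right[OF mi_power_add_binomial[of m z h], of "g m"]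
      by (simp add: T_def B_def zh)
    moreover have "((\<lambda>m. g m * mi_power w m) has_sum G w) UNIV"
      using G wD by (simp add: power_series_on_polydisc_def)
    ultimately have T: "(T has_sum G w) (UNIV \<times> UNIV)"
      by (intro has_sum_SigmaI[where g = "\<lambda>m. g m * mi_power w m"]) auto
    then have T': "((\<lambda>(k, m). T (m, k)) has_sum G w) (UNIV \<times> UNIV)"
      by (subst (asm) has_sum_swap)
    have "((\<lambda>k. c k * mi_power h k) has_sum G w) UNIV"
    proof (rule has_sum_SigmaD[OF T'])
      fix k :: "nat ^ 'd"
      have "(\<lambda>(k, m). T (m, k)) summable_on (UNIV \<times> UNIV)"
        using T' by (rule has_sum_imp_summable)
      then have "(\<lambda>m. T (m, k)) summable_on UNIV"
        using summable_on_SigmaD1[of "\<lambda>k m. T (m, k)" UNIV "\<lambda>_. UNIV" k] by simp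
      moreover have "(\<Sum>\<^sub>\<infinity>m. T (m, k)) = c k * mi_power h k"
        unfolding c_def infsum_cmult_left'[symmetric] by (simp add: T_def mult.assoc)
      ultimately show "((\<lambda>m. (\<lambda>(k, m). T (m, k)) (k, m)) has_sum c k * mi_power h k) UNIV"
        by (metis (no_types, lifting) case_prod_conv has_sum_cong has_sum_infsum)
    qed
    then show ?thesis by (simp add: h_def)
  qed
  ultimately show "\<exists>c. \<exists>r>0. \<forall>w. (\<forall>l. cmod (w $ l - z $ l) < r) \<longrightarrow>
      ((\<lambda>n. c n * mi_power (w - z) n) has_sum G w) UNIV" by blast
qed

section \<open>Subexponential decay\<close>

text \<open>
  The condition on $a$ in the equivalence, with $b = e^c$; the exponential form makes it easy to split
  the rate $c$ into halves.
\<close>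

definition subexp_decay :: "real \<Rightarrow> (nat ^ 'd::finite \<Rightarrow> complex) \<Rightarrow> bool" where
  "subexp_decay s g \<longleftrightarrow>
     (\<exists>C>0. \<exists>c>0. \<forall>n. cmod (g n) \<le> C * exp (- c * real (mi_size n) powr s))"

lemma subexp_decay_iff_powr:
  "subexp_decay s g \<longleftrightarrow>
     (\<exists>C>0. \<exists>b>1. \<forall>n. cmod (g n) \<le> C * b powr (- (real (mi_size n) powr s)))"
proof -
  have eq: "exp (- c * x) = exp c powr (- x)" for c x :: real
    by (simp add: exp_powr_real)
  have eq': "b powr (- x) = exp (- ln b * x)" if "b > 1" for b x :: real
    using that by (simp add: powr_def mult.commute)
  show ?thesis
  proof
    assume "subexp_decay s g"
    then obtain C c where "C > 0" "c > 0" "\<forall>n. cmod (g n) \<le> C * exp (- c * real (mi_size n) powr s)"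
      unfolding subexp_decay_def by blast
    then show "\<exists>C>0. \<exists>b>1. \<forall>n. cmod (g n) \<le> C * b powr (- (real (mi_size n) powr s))"
      unfolding eq by (intro exI[of _ C] conjI exI[of _ "exp c"]) auto
  next
    assume "\<exists>C>0. \<exists>b>1. \<forall>n. cmod (g n) \<le> C * b powr (- (real (mi_size n) powr s))"
    then obtain C b where "C > 0" "b > 1" "\<forall>n. cmod (g n) \<le> C * b powr (- (real (mi_size n) powr s))"
      by blast
    then show "subexp_decay s g"
      unfolding subexp_decay_def
      by (intro exI[of _ C] conjI exI[of _ "ln b"]) (auto simp: eq')
  qed
qed

definition tends_to_zero :: "(nat ^ 'd::finite \<Rightarrow> complex) \<Rightarrow> bool" where
  "tends_to_zero g \<longleftrightarrow> (g \<longlongrightarrow> 0) (filtercomap mi_size at_top)"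

lemma tends_to_zero_iff:
  "tends_to_zero g \<longleftrightarrow> (\<forall>e>0. \<exists>N. \<forall>m. mi_size m \<ge> N \<longrightarrow> cmod (g m) < e)"
  unfolding tends_to_zero_def tendsto_iff eventually_filtercomap_at_top_linorder by simp

lemma mi_size_diff_axis:
  fixes m :: "nat ^ 'd::finite"
  assumes "m $ l \<noteq> 0"
  shows "mi_size m = Suc (mi_size (m - axis l 1))"
proof -
  have "m = (m - axis l 1) + axis l 1"
    using assms by (auto simp: vec_eq_iff axis_nth)
  then have "mi_size m = mi_size (m - axis l 1) + mi_size (axis l 1 :: nat ^ 'd)"
    by (metis mi_size_add)
  then show ?thesis by simp
qed

lemma tends_to_zero_backward_diff:
  assumes "tends_to_zero g"
  shows "tends_to_zero (backward_diff l g)"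
  unfolding tends_to_zero_iff
proof (intro allI impI)
  fix e :: real assume "e > 0"
  then obtain N where N: "\<And>m. mi_size m \<ge> N \<Longrightarrow> cmod (g m) < e / 2"
    using assms unfolding tends_to_zero_iff by (metis half_gt_zero)
  have "cmod (backward_diff l g m) < e" if "mi_size m \<ge> Suc N" for m
  proof -
    have "cmod (if m $ l = 0 then 0 else g (m - axis l 1)) < e / 2"
    proof (cases "m $ l = 0")
      case False
      then show ?thesis using that mi_size_diff_axis[OF False] N[of "m - axis l 1"] by simp
    qed (use \<open>e > 0\<close> in simp)
    moreover have "cmod (g m) < e / 2" using that by (intro N) simp
    ultimately show ?thesis
      unfolding backward_diff_def using norm_triangle_ineq4 by (smt (verit) field_sum_of_halves)
  qed
  then show "\<exists>N. \<forall>m. mi_size m \<ge> N \<longrightarrow> cmod (backward_diff l g m) < e" by blast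
qed

lemma nth_le_mi_size: "m $ l \<le> mi_size (m :: nat ^ 'd::finite)"
  unfolding mi_size_def by (rule member_le_sum) auto

lemma tends_to_zero_bounded:
  fixes g :: "nat ^ 'd::finite \<Rightarrow> complex"
  assumes "tends_to_zero g"
  obtains B where "\<And>m. cmod (g m) \<le> B"
proof -
  obtain N where N: "\<And>m. mi_size m \<ge> N \<Longrightarrow> cmod (g m) < 1"
    using assms unfolding tends_to_zero_iff by (meson zero_less_one)
  let ?S = "{m :: nat ^ 'd. \<forall>l. m $ l \<le> N}"
  have "cmod (g m) \<le> 1 + (\<Sum>m\<in>?S. cmod (g m))" for m
  proof (cases "mi_size m \<ge> N")
    case True
    have "0 \<le> (\<Sum>m\<in>?S. cmod (g m))" by (intro sum_nonneg) auto
    then show ?thesis using N[OF True] by linarith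
  next
    case False
    have "m $ l \<le> N" for l using nth_le_mi_size[of m l] False by linarith
    then have "m \<in> ?S" by blast
    then have "cmod (g m) \<le> (\<Sum>m\<in>?S. cmod (g m))"
      by (intro member_le_sum finite_box) auto
    then show ?thesis by linarith
  qed
  then show ?thesis using that by blast
qed

text \<open>
  Subadditivity gives $|n|^s \le (|n| - 1)^s + 1$, so the shifted coefficient costs only a factor $e^c$.
\<close>

lemma subexp_decay_backward_diff:
  assumes s: "0 < s" "s \<le> 1" and g: "subexp_decay s g"
  shows "subexp_decay s (backward_diff l g)"
proof -
  obtain C c where C: "C > 0" and c: "c > 0"
    and le: "\<And>n. cmod (g n) \<le> C * exp (- c * real (mi_size n) powr s)"
    using g unfolding subexp_decay_def by blast
  have "cmod (backward_diff l g n) \<le> (C * (1 + exp c)) * exp (- c * real (mi_size n) powr s)" for n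
  proof -
    let ?E = "exp (- c * real (mi_size n) powr s)"
    have "cmod (if n $ l = 0 then 0 else g (n - axis l 1)) \<le> C * exp c * ?E"
    proof (cases "n $ l = 0")
      case False
      let ?k = "mi_size (n - axis l 1)"
      have "real (mi_size n) powr s = (real ?k + 1) powr s"
        using mi_size_diff_axis[OF False] by (simp add: add.commute)
      also have "\<dots> \<le> real ?k powr s + 1"
        using powr_subadditive[of "real ?k" 1 s] s by simp
      finally have "c * real (mi_size n) powr s \<le> c * (real ?k powr s + 1)"
        using c by (intro mult_left_mono) auto
      then have "exp (- c * real ?k powr s) \<le> exp (c + - c * real (mi_size n) powr s)"
        by (simp add: algebra_simps)
      then have "C * exp (- c * real ?k powr s) \<le> C * exp (c + - c * real (mi_size n) powr s)"
        using C by (intro mult_left_mono less_imp_le[OF C])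
      also have "\<dots> = C * exp c * ?E" by (simp only: exp_add mult.assoc)
      finally show ?thesis using False order.trans[OF le[of "n - axis l 1"]] by simp
    qed (use C in auto)
    moreover have "cmod (backward_diff l g n)
        \<le> cmod (g n) + cmod (if n $ l = 0 then 0 else g (n - axis l 1))"
      unfolding backward_diff_def by (rule norm_triangle_ineq4)
    ultimately show ?thesis using le[of n] by (simp add: algebra_simps)
  qed
  moreover have "C * (1 + exp c) > 0" using C by (simp add: add_pos_pos)
  ultimately show ?thesis unfolding subexp_decay_def using c by blast
qed

text \<open>
  Telescoping along the line $n + k e_l$ and $g \to 0$ give
  $g_n = -\sum_{k \ge 0} (\Delta_l g)_{n + (k+1) e_l}$. The index there has size at least $|n|$ and at
  least $k$, so half of the decay rate can be spent on each: one half survives as decay in $|n|$, the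
  other makes the sum over $k$ converge.
\<close>

lemma subexp_decay_of_backward_diff:
  fixes g :: "nat ^ 'd::finite \<Rightarrow> complex"
  assumes s: "0 < s" and g0: "tends_to_zero g" and D: "subexp_decay s (backward_diff l g)"
  shows "subexp_decay s g"
proof -
  obtain C c where C: "C > 0" and c: "c > 0"
    and le: "\<And>n. cmod (backward_diff l g n) \<le> C * exp (- c * real (mi_size n) powr s)"
    using D unfolding subexp_decay_def by blast
  define S where "S = (\<Sum>k. exp (- (c / 2) * real k powr s))"
  have sm: "summable (\<lambda>k. exp (- (c / 2) * real k powr s))"
    using summable_exp_neg_powr[of "c / 2" s] c s by simp
  have S: "S > 0" unfolding S_def by (rule suminf_pos[OF sm]) auto
  have "cmod (g n) \<le> (C * S) * exp (- (c / 2) * real (mi_size n) powr s)" for n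
  proof -
    let ?E = "exp (- (c / 2) * real (mi_size n) powr s)"
    let ?v = "\<lambda>k. n + axis l k"
    have step: "cmod (backward_diff l g (?v (Suc k))) \<le> C * ?E * exp (- (c / 2) * real k powr s)" for k
    proof -
      let ?t = "real (mi_size n + Suc k) powr s"
      have "real (mi_size n) powr s \<le> ?t" "real k powr s \<le> ?t"
        using s by (auto intro!: powr_mono2)
      then have "(c / 2) * (real (mi_size n) powr s + real k powr s) \<le> (c / 2) * (2 * ?t)"
        using c by (intro mult_left_mono) auto
      then have "exp (- c * ?t) \<le> exp (- (c / 2) * real (mi_size n) powr s + - (c / 2) * real k powr s)"
        by (simp add: algebra_simps)
      then have "C * exp (- c * ?t) \<le> C * (?E * exp (- (c / 2) * real k powr s))"
        using C unfolding exp_add by simp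
      then show ?thesis using le[of "?v (Suc k)"] by (simp add: mi_size_add mult.assoc)
    qed
    have bound: "cmod (g n) \<le> C * ?E * S + cmod (g (?v K))" for K
    proof -
      have tele: "g (?v K) - g (?v 0) = (\<Sum>k<K. backward_diff l g (?v (Suc k)))"
        unfolding backward_diff_add_axis by (rule sum_lessThan_telescope[symmetric])
      have "?v 0 = n" by (auto simp: vec_eq_iff axis_nth)
      then have "g n = g (?v K) - (\<Sum>k<K. backward_diff l g (?v (Suc k)))"
        using tele by (metis diff_diff_eq2 add_diff_cancel_left')
      then have "cmod (g n) \<le> cmod (g (?v K)) + cmod (\<Sum>k<K. backward_diff l g (?v (Suc k)))"
        by (metis norm_triangle_ineq4)
      also have "cmod (\<Sum>k<K. backward_diff l g (?v (Suc k)))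
          \<le> (\<Sum>k<K. C * ?E * exp (- (c / 2) * real k powr s))"
        by (intro sum_norm_le step)
      also have "\<dots> = C * ?E * (\<Sum>k<K. exp (- (c / 2) * real k powr s))"
        by (rule sum_distrib_left[symmetric])
      also have "\<dots> \<le> C * ?E * S"
        unfolding S_def using C by (intro mult_left_mono sum_le_suminf sm) auto
      finally show ?thesis by simp
    qed
    have "cmod (g n) \<le> C * ?E * S + e" if "e > 0" for e
    proof -
      obtain N where N: "\<And>m. mi_size m \<ge> N \<Longrightarrow> cmod (g m) < e"
        using g0 \<open>e > 0\<close> unfolding tends_to_zero_iff by blast
      then have "cmod (g (?v N)) < e" by (simp add: mi_size_add)
      then show ?thesis using bound[of N] by linarith
    qed
    then have "cmod (g n) \<le> C * ?E * S" by (rule field_le_epsilon)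
    then show ?thesis by (simp add: mult_ac)
  qed
  then show ?thesis unfolding subexp_decay_def using C S c
    by (intro exI[of _ "C * S"] conjI exI[of _ "c / 2"]) auto
qed

text \<open>
  Differences are applied along a list of directions so that their properties follow by induction on it.
\<close>

definition total_diff :: "(nat ^ 'd::finite \<Rightarrow> complex) \<Rightarrow> 'd list \<Rightarrow> nat ^ 'd \<Rightarrow> complex" where
  "total_diff g ls = foldr backward_diff ls g"

lemma total_diff_simps [simp]:
  "total_diff g [] = g" "total_diff g (l # ls) = backward_diff l (total_diff g ls)"
  by (simp_all add: total_diff_def)

lemma tends_to_zero_total_diff:
  "tends_to_zero g \<Longrightarrow> tends_to_zero (total_diff g ls)"
  by (induction ls) (auto intro: tends_to_zero_backward_diff)

lemma subexp_decay_total_diff_iff: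
  assumes "0 < s" "s \<le> 1" "tends_to_zero g"
  shows "subexp_decay s (total_diff g ls) \<longleftrightarrow> subexp_decay s g"
proof (induction ls)
  case (Cons l ls)
  then show ?case
    using subexp_decay_backward_diff[OF assms(1,2), of "total_diff g ls" l]
      subexp_decay_of_backward_diff[OF assms(1) tends_to_zero_total_diff[OF assms(3)], of l ls]
    by auto
qed simp

lemma power_series_total_diff:
  assumes "power_series_on_polydisc G g" "distinct ls"
  shows "power_series_on_polydisc (\<lambda>w. (\<Prod>l\<in>set ls. 1 - w $ l) * G w) (total_diff g ls)"
  using assms(2)
proof (induction ls)
  case (Cons l ls)
  then have "power_series_on_polydisc (\<lambda>w. (1 - w $ l) * ((\<Prod>l\<in>set ls. 1 - w $ l) * G w))
      (backward_diff l (total_diff g ls))"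
    by (intro power_series_mult_one_minus) auto
  then show ?case using Cons.prems by (simp add: mult.assoc)
qed (use assms in simp)

section \<open>Gevrey bounds and coefficient decay\<close>

lemma mi_self_powr_eq: "mi_self_powr \<alpha> p = (\<Prod>l\<in>UNIV. self_powr \<alpha> (p $ l))"
  by (simp add: mi_self_powr_def self_powr_def)

lemma fact_add_le: "fact (k + p) \<le> fact k * real (k + p) ^ p"
proof (induction p)
  case (Suc p)
  have "fact (k + Suc p) = real (k + Suc p) * fact (k + p)" by simp
  also have "\<dots> \<le> real (k + Suc p) * (fact k * real (k + Suc p) ^ p)"
  proof (intro mult_left_mono)
    have "real (k + p) ^ p \<le> real (k + Suc p) ^ p" by (intro power_mono) auto
    then show "fact (k + p) \<le> fact k * real (k + Suc p) ^ p"
      using Suc by (meson fact_ge_zero mult_left_mono order.trans)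
  qed auto
  finally show ?case by (simp add: mult_ac)
qed simp

definition gevrey_bound ::
    "real \<Rightarrow> (complex ^ 'd::{finite,linorder} \<Rightarrow> complex) \<Rightarrow> bool" where
  "gevrey_bound \<alpha> G \<longleftrightarrow> (\<exists>C>0. \<exists>A>0. \<forall>p. \<forall>w\<in>unit_polydisc.
     cmod (mixed_deriv p G w) \<le> C * A ^ mi_size p * mi_self_powr \<alpha> p)"

lemma power_mi_size: "(A :: real) ^ mi_size p = (\<Prod>l\<in>UNIV. A ^ (p $ l))"
  by (simp add: mi_size_def power_sum)

text \<open>
  The Cauchy estimate for $D^p G$ holds with the order $p$ free, so $p$ may be adapted to the coefficient
  $g_n$ under consideration, optimally in each coordinate separately.
\<close>

lemma gevrey_imp_decay:
  fixes g :: "nat ^ 'd::{finite,linorder} \<Rightarrow> complex"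
  assumes \<alpha>: "\<alpha> \<ge> 1" and G: "power_series_on_polydisc G g" and gev: "gevrey_bound \<alpha> G"
  shows "subexp_decay (1 / \<alpha>) g"
proof -
  obtain C A where C: "C > 0" and A: "A > 0"
    and bd: "\<And>p w. w \<in> unit_polydisc \<Longrightarrow>
      cmod (mixed_deriv p G w) \<le> C * A ^ mi_size p * mi_self_powr \<alpha> p"
    using gev unfolding gevrey_bound_def by blast
  obtain c where c: "c > 0" and opt: "\<And>n. \<exists>p\<le>n. A ^ p * self_powr \<alpha> p * fact (n - p) / fact n
      \<le> exp 1 * exp (- c * real n powr (1 / \<alpha>))"
    using optimal_derivative_order[OF \<alpha> A] by blast
  have "cmod (g n) \<le> (C * exp 1 ^ CARD('d)) * exp (- c * real (mi_size n) powr (1 / \<alpha>))" for n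
  proof -
    have "\<exists>q. \<forall>l. q l \<le> n $ l \<and>
        A ^ q l * self_powr \<alpha> (q l) * fact (n $ l - q l) / fact (n $ l)
          \<le> exp 1 * exp (- c * real (n $ l) powr (1 / \<alpha>))"
      by (rule choice) (use opt in blast)
    then obtain q where q: "\<And>l. q l \<le> n $ l"
      "\<And>l. A ^ q l * self_powr \<alpha> (q l) * fact (n $ l - q l) / fact (n $ l)
         \<le> exp 1 * exp (- c * real (n $ l) powr (1 / \<alpha>))"
      by blast
    define p where "p = (\<chi> l. q l)"
    define m where "m = n - p"
    have nm: "m + p = n" using q(1) by (simp add: m_def p_def vec_eq_iff)
    let ?R = "\<Prod>l\<in>UNIV. fact (n $ l) / fact (n $ l - q l) :: real"
    have R: "?R > 0" by (intro prod_pos) auto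
    have "cmod (of_real (\<Prod>l\<in>UNIV. fact (m $ l + p $ l) / fact (m $ l)) * g (m + p))
        \<le> C * A ^ mi_size p * mi_self_powr \<alpha> p"
      by (rule Cauchy_estimate_polydisc[OF power_series_mixed_deriv[OF G]]) (rule bd)
    also have "(\<Prod>l\<in>UNIV. fact (m $ l + p $ l) / fact (m $ l)) = ?R"
      using q(1) by (intro prod.cong) (auto simp: m_def p_def)
    finally have "?R * cmod (g n) \<le> C * A ^ mi_size p * mi_self_powr \<alpha> p"
      using R by (simp add: nm norm_mult del: of_real_prod)
    then have "cmod (g n) \<le> C * A ^ mi_size p * mi_self_powr \<alpha> p / ?R"
      using R by (simp add: pos_le_divide_eq mult.commute)
    also have "\<dots> = C * (\<Prod>l\<in>UNIV. A ^ q l * self_powr \<alpha> (q l) * fact (n $ l - q l) / fact (n $ l))"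
      by (simp add: power_mi_size mi_self_powr_eq prod.distrib prod_dividef p_def)
    also have "\<dots> \<le> C * (\<Prod>l\<in>UNIV. exp 1 * exp (- c * real (n $ l) powr (1 / \<alpha>)))"
      using C A q(2) by (intro mult_left_mono prod_mono) (auto simp: self_powr_def)
    also have "\<dots> = C * exp 1 ^ CARD('d) * exp (- c * (\<Sum>l\<in>UNIV. real (n $ l) powr (1 / \<alpha>)))"
      by (simp add: prod.distrib exp_sum[symmetric] sum_distrib_left sum_negf)
    also have "\<dots> \<le> C * exp 1 ^ CARD('d) * exp (- c * real (mi_size n) powr (1 / \<alpha>))"
    proof -
      have "real (mi_size n) powr (1 / \<alpha>) \<le> (\<Sum>l\<in>UNIV. real (n $ l) powr (1 / \<alpha>))"
        unfolding mi_size_def of_nat_sum using \<alpha> by (intro powr_sum_le) auto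
      then show ?thesis using C c by (intro mult_left_mono) auto
    qed
    finally show ?thesis .
  qed
  then show ?thesis unfolding subexp_decay_def using C c
    by (intro exI[of _ "C * exp 1 ^ CARD('d)"] conjI exI[of _ c]) auto
qed

text \<open>
  The rate $d$ is chosen such that $2d \sum_l n_l^{1/\alpha} \le c |n|^{1/\alpha}$, which holds as each
  $n_l$ is at most $|n|$. In every coordinate one factor $\exp(-d n_l^{1/\alpha})$ controls the growth of
  the differentiated monomial and the second one is left for the summation over $n$.
\<close>

lemma decay_imp_gevrey:
  fixes g :: "nat ^ 'd::{finite,linorder} \<Rightarrow> complex"
  assumes \<alpha>: "\<alpha> \<ge> 1" and G: "power_series_on_polydisc G g" and dec: "subexp_decay (1 / \<alpha>) g"
  shows "gevrey_bound \<alpha> G"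
proof -
  obtain C c where C: "C > 0" and c: "c > 0"
    and le: "\<And>n. cmod (g n) \<le> C * exp (- c * real (mi_size n) powr (1 / \<alpha>))"
    using dec unfolding subexp_decay_def by blast
  define d where "d = c / (2 * real CARD('d))"
  have d: "d > 0" using c by (simp add: d_def)
  define A where "A = (\<alpha> / d) powr \<alpha>"
  have A: "A > 0" using \<alpha> d by (simp add: A_def)
  let ?e = "\<lambda>k. exp (- d * real k powr (1 / \<alpha>))"
  have sm: "summable ?e" using summable_exp_neg_powr[of d "1 / \<alpha>"] d \<alpha> by simp
  have S: "suminf ?e > 0" by (rule suminf_pos[OF sm]) auto
  have split: "exp (- c * real (mi_size n) powr (1 / \<alpha>)) \<le> (\<Prod>l\<in>UNIV. ?e (n $ l) * ?e (n $ l))"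
    for n :: "nat ^ 'd::{finite,linorder}"
  proof -
    have "(\<Sum>l\<in>UNIV. real (n $ l) powr (1 / \<alpha>)) \<le> (\<Sum>l\<in>(UNIV :: 'd set). real (mi_size n) powr (1 / \<alpha>))"
      using \<alpha> nth_le_mi_size[of n] by (intro sum_mono powr_mono2) auto
    then have "2 * d * (\<Sum>l\<in>UNIV. real (n $ l) powr (1 / \<alpha>)) \<le> c * real (mi_size n) powr (1 / \<alpha>)"
      using c by (simp add: d_def field_simps)
    then have "exp (- c * real (mi_size n) powr (1 / \<alpha>)) \<le> exp (- (2 * d * (\<Sum>l\<in>UNIV. real (n $ l) powr (1 / \<alpha>))))"
      by simp
    also have "\<dots> = (\<Prod>l\<in>UNIV. ?e (n $ l) * ?e (n $ l))"
      by (simp add: exp_sum[symmetric] sum_distrib_left sum_negf exp_add[symmetric] mult.assoc)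
    finally show ?thesis .
  qed
  have "cmod (mixed_deriv p G w) \<le> (C * suminf ?e ^ CARD('d)) * A ^ mi_size p * mi_self_powr \<alpha> p"
    if w: "w \<in> unit_polydisc" for p w
  proof -
    let ?M = "A ^ mi_size p * mi_self_powr \<alpha> p"
    let ?R = "\<lambda>m. \<Prod>l\<in>UNIV. fact (m $ l + p $ l) / fact (m $ l) :: real"
    have M: "?M \<ge> 0" using A by (auto simp: mi_self_powr_eq self_powr_def intro!: mult_nonneg_nonneg prod_nonneg)
    have term_le: "cmod (of_real (?R m) * g (m + p) * mi_power w m)
        \<le> C * ?M * (\<Prod>l\<in>UNIV. ?e (m $ l))" for m
    proof -
      have R: "?R m \<ge> 0" by (intro prod_nonneg) auto
      have "cmod (mi_power w m) \<le> 1"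
        unfolding norm_mi_power using w by (intro prod_le_1) (simp add: unit_polydisc_def power_le_one less_imp_le)
      then have "cmod (of_real (?R m) * g (m + p) * mi_power w m) \<le> ?R m * cmod (g (m + p)) * 1"
        unfolding norm_mult norm_of_real abs_of_nonneg[OF R]
        by (intro mult_left_mono mult_nonneg_nonneg R) auto
      also have "\<dots> \<le> ?R m * (C * (\<Prod>l\<in>UNIV. ?e ((m + p) $ l) * ?e ((m + p) $ l)))"
      proof -
        have "cmod (g (m + p)) \<le> C * (\<Prod>l\<in>UNIV. ?e ((m + p) $ l) * ?e ((m + p) $ l))"
          using le mult_left_mono[OF split less_imp_le[OF C]] by (rule order.trans)
        then show ?thesis unfolding mult_1_right by (rule mult_left_mono) (rule R)
      qed
      also have "\<dots> = C * (\<Prod>l\<in>UNIV. fact (m $ l + p $ l) / fact (m $ l) * ?e (m $ l + p $ l) * ?e (m $ l + p $ l))"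
        by (simp only: prod.distrib vector_add_component mult_ac)
      also have "\<dots> \<le> C * (\<Prod>l\<in>UNIV. A ^ (p $ l) * self_powr \<alpha> (p $ l) * ?e (m $ l))"
      proof (intro mult_left_mono prod_mono conjI)
        fix l
        let ?t = "m $ l + p $ l"
        have "fact ?t / fact (m $ l) \<le> real ?t ^ (p $ l)"
          using fact_add_le[of "m $ l" "p $ l"] by (simp add: divide_le_eq mult.commute)
        then have "fact ?t / fact (m $ l) * ?e ?t \<le> real ?t ^ (p $ l) * ?e ?t"
          by (intro mult_right_mono) auto
        also have "\<dots> \<le> A ^ (p $ l) * self_powr \<alpha> (p $ l)"
          unfolding A_def using power_times_exp_neg_powr_le[of d \<alpha> ?t "p $ l"] d \<alpha> by simp
        finally have 1: "fact ?t / fact (m $ l) * ?e ?t \<le> A ^ (p $ l) * self_powr \<alpha> (p $ l)" .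
        have "real (m $ l) powr (1 / \<alpha>) \<le> real ?t powr (1 / \<alpha>)"
          using \<alpha> by (intro powr_mono2) auto
        then have 2: "?e ?t \<le> ?e (m $ l)" using d by simp
        show "fact ?t / fact (m $ l) * ?e ?t * ?e ?t \<le> A ^ (p $ l) * self_powr \<alpha> (p $ l) * ?e (m $ l)"
          using A by (intro mult_mono 1 2) (auto simp: self_powr_def)
      qed (use C in auto)
      also have "\<dots> = C * ?M * (\<Prod>l\<in>UNIV. ?e (m $ l))"
        by (simp add: prod.distrib power_mi_size mi_self_powr_eq)
      finally show ?thesis .
    qed
    have "(\<lambda>m :: nat ^ 'd::{finite,linorder}. \<Prod>l\<in>UNIV. ?e (m $ l)) summable_on UNIV"
      by (rule multi_sum_prod) (use sm in auto)
    then have majorant: "((\<lambda>m :: nat ^ 'd::{finite,linorder}. C * ?M * (\<Prod>l\<in>UNIV. ?e (m $ l))) has_sum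
        C * ?M * (\<Sum>\<^sub>\<infinity>m :: nat ^ 'd::{finite,linorder}. \<Prod>l\<in>UNIV. ?e (m $ l))) UNIV"
      by (intro has_sum_cmult_right) simp
    have series: "((\<lambda>m. of_real (?R m) * g (m + p) * mi_power w m) has_sum mixed_deriv p G w) UNIV"
      using power_series_mixed_deriv[OF G, of p] w unfolding power_series_on_polydisc_def by blast
    have "cmod (mixed_deriv p G w) \<le> C * ?M * (\<Sum>\<^sub>\<infinity>m :: nat ^ 'd::{finite,linorder}. \<Prod>l\<in>UNIV. ?e (m $ l))"
      by (rule norm_infsum_le[OF series majorant term_le])
    also have "\<dots> \<le> C * ?M * (\<Prod>l\<in>(UNIV :: 'd set). suminf ?e)"
      using C M sm by (intro mult_left_mono multi_sum_prod) auto
    finally show ?thesis by (simp add: mult_ac)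
  qed
  then show ?thesis unfolding gevrey_bound_def using C S A
    by (intro exI[of _ "C * suminf ?e ^ CARD('d)"] conjI exI[of _ A]) auto
qed

section \<open>The equivalence for $F$\<close>

theorem proposition5p4:
  fixes \<alpha> :: real
    and a :: "nat ^ 'd::{finite,linorder} \<Rightarrow> complex"
    and F :: "complex ^ 'd::{finite,linorder} \<Rightarrow> complex"
  assumes "\<alpha> \<ge> 1"
    and "(a \<longlongrightarrow> 0) (filtercomap mi_size at_top)"
    and "\<And>w. w \<in> unit_polydisc \<Longrightarrow>
           F w = (\<Prod>l\<in>UNIV. 1 - w $ l) * (\<Sum>\<^sub>\<infinity>n\<in>UNIV. a n * mi_power w n)"
  shows "(\<forall>w\<in>unit_polydisc. (\<lambda>n. a n * mi_power w n) summable_on UNIV) \<and>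
         multi_analytic_on F unit_polydisc \<and>
         ((\<exists>C>0. \<exists>A>0. \<forall>p. \<forall>w\<in>unit_polydisc.
             cmod (mixed_deriv p F w) \<le> C * A ^ mi_size p * mi_self_powr \<alpha> p) \<longleftrightarrow>
          (\<exists>c>0. \<exists>b>1. \<forall>n.
             cmod (a n) \<le> c * b powr (- (real (mi_size n) powr (1 / \<alpha>)))))"
proof -
  have a0: "tends_to_zero a" using assms(2) by (simp add: tends_to_zero_def)
  obtain B where B: "\<And>m. cmod (a m) \<le> B" using tends_to_zero_bounded[OF a0] by blast
  have summ: "\<forall>w\<in>unit_polydisc. (\<lambda>n. a n * mi_power w n) summable_on UNIV"
    using power_series_bounded_coeff[of a B] B by blast
  define f where "f = total_diff a (sorted_list_of_set UNIV)"
  have "power_series_on_polydisc (\<lambda>w. \<Sum>\<^sub>\<infinity>n. a n * mi_power w n) a"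
    using summ by (simp add: power_series_on_polydisc_def)
  from power_series_total_diff[OF this, of "sorted_list_of_set UNIV"]
  have F: "power_series_on_polydisc F f"
    by (simp add: f_def power_series_on_polydisc_def assms(3))
  have "gevrey_bound \<alpha> F \<longleftrightarrow> subexp_decay (1 / \<alpha>) f"
    using gevrey_imp_decay[OF assms(1) F] decay_imp_gevrey[OF assms(1) F] by blast
  also have "\<dots> \<longleftrightarrow> subexp_decay (1 / \<alpha>) a"
    unfolding f_def using assms(1) by (intro subexp_decay_total_diff_iff a0) auto
  finally have "gevrey_bound \<alpha> F \<longleftrightarrow> subexp_decay (1 / \<alpha>) a" .
  then show ?thesis
    using summ power_series_imp_analytic[OF F]
    unfolding gevrey_bound_def subexp_decay_iff_powr by blast
qed

end
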